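(* Let $(X,\mathcal{B})$ be an $\mathbf{S}_2$ ball space and let $f:X\to X$ be a function. If every ball in $\mathcal{B}$ contains a fixed point of $f$ or a smaller ball (that is, a ball $B'\in\mathcal{B}$ properly contained in it), then $f$ has a fixed point in every ball.
   Context: A ball space $(X,\mathcal{B})$ consists of a nonempty set $X$ and a nonempty family $\mathcal{B}$ of nonempty subsets of $X$, called balls. A nest of balls is a nonempty subset of $\mathcal{B}$ which is totally ordered by inclusion. $(X,\mathcal{B})$ is an $\mathbf{S}_2$ ball space if the intersection of each nest of balls contains a ball, that is, has a subset belonging to $\mathcal{B}$. *)

theory Defs
  imports "HOL-Library.FuncSet"
begin

definition ball_space :: "'a set \<Rightarrow> 'a set set \<Rightarrow> bool" where
  "ball_space X \<B> \<longleftrightarrow> X \<noteq> {} \<and> \<B> \<noteq> {} \<and> (\<forall>B\<in>\<B>. B \<subseteq> X \<and> B \<noteq> {})"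

definition nest_of_balls :: "'a set set \<Rightarrow> 'a set set \<Rightarrow> bool" where
  "nest_of_balls \<B> N \<longleftrightarrow> N \<noteq> {} \<and> subset.chain \<B> N"

definition S2_ball_space :: "'a set \<Rightarrow> 'a set set \<Rightarrow> bool" where
  "S2_ball_space X \<B> \<longleftrightarrow>
     ball_space X \<B> \<and> (\<forall>N. nest_of_balls \<B> N \<longrightarrow> (\<exists>B\<in>\<B>. B \<subseteq> \<Inter>N))"

end

theory Submission
  imports Defs
begin

text \<open>The function \<open>f\<close> is only tested against balls that are minimal with respect to inclusion:
such a ball contains no smaller one, so the hypothesis forces it to contain a fixed point. The
theorem therefore reduces to the existence of a minimal ball inside every ball. This is
a Zorn-type argument; the \<open>S\<^sub>2\<close> property is exactly the statement that nests have lower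
bounds in the set of balls.\<close>

text \<open>Take a maximal nest \<open>M\<close> among the balls inside \<open>B\<close> and a ball \<open>C\<close> in its intersection.
A ball properly contained in \<open>C\<close> would lie properly below every member of \<open>M\<close> and could be
added to \<open>M\<close>, against maximality.\<close>

lemma S2_ball_space_minimal_ball:
  assumes S2: "S2_ball_space X \<B>" and B: "B \<in> \<B>"
  obtains C where "C \<in> \<B>" "C \<subseteq> B" "\<And>D. D \<in> \<B> \<Longrightarrow> \<not> D \<subset> C"
proof -
  define \<A> where "\<A> = {C \<in> \<B>. C \<subseteq> B}"
  obtain M where M: "subset.maxchain \<A> M"
    using subset.Hausdorff by blast
  then have chain: "subset.chain \<A> M"
    by (rule subset.maxchain_imp_chain)
  have maximal: "M' = M" if "subset.chain \<A> M'" "M \<subseteq> M'" for M'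
    using M that unfolding subset.maxchain_def by blast
  have "M \<noteq> {}"
  proof
    assume "M = {}"
    moreover have "subset.chain \<A> {B}"
      using B by (auto simp: \<A>_def subset_chain_def)
    ultimately show False using maximal[of "{B}"] by blast
  qed
  with chain have "nest_of_balls \<B> M"
    by (auto simp: nest_of_balls_def subset_chain_def \<A>_def)
  with S2 obtain C where C: "C \<in> \<B>" "C \<subseteq> \<Inter>M"
    unfolding S2_ball_space_def by blast
  have "C \<subseteq> B"
    using C(2) \<open>M \<noteq> {}\<close> chain by (auto simp: subset_chain_def \<A>_def)
  moreover have "\<not> D \<subset> C" if D: "D \<in> \<B>" for D
  proof
    assume "D \<subset> C"
    then have below: "D \<subset> E" if "E \<in> M" for E
      using C(2) that by blast
    have "subset.chain \<A> (insert D M)"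
      unfolding subset_chain_insert
      using chain below D \<open>D \<subset> C\<close> \<open>C \<subseteq> B\<close> by (auto simp: \<A>_def)
    then have "D \<in> M" using maximal[of "insert D M"] by blast
    then show False using below by blast
  qed
  ultimately show thesis using that C(1) by blast
qed

theorem theorem2p3:
  fixes X :: "'a set" and \<B> :: "'a set set" and f :: "'a \<Rightarrow> 'a"
  assumes "S2_ball_space X \<B>"
    and "f \<in> X \<rightarrow> X"
    and "\<And>B. B \<in> \<B> \<Longrightarrow> (\<exists>x\<in>B. f x = x) \<or> (\<exists>B'\<in>\<B>. B' \<subset> B)"
  shows "\<forall>B\<in>\<B>. \<exists>x\<in>B. f x = x"
proof
  fix B assume "B \<in> \<B>"
  with assms(1) obtain C where "C \<in> \<B>" "C \<subseteq> B" "\<And>D. D \<in> \<B> \<Longrightarrow> \<not> D \<subset> C"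
    by (rule S2_ball_space_minimal_ball) blast
  then show "\<exists>x\<in>B. f x = x"
    using assms(3)[of C] by blast
qed

end
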